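(* Let $M$ be a matroid of rank $k$ on a finite ground set $E$. The following are equivalent: (1) $M$ is threshold; (2) $M$ is $2$-uniform assumable, i.e., for all bases $B_1,B_2$ of $M$ and all $k$-element non-bases $D_1,D_2\subseteq E$, the multiset union $B_1+B_2$ differs from the multiset union $D_1+D_2$; (3) for all bases $B_1,B_2$ of $M$ and all $k$-element non-bases $D_1,D_2\subseteq E$, we have $B_1\cup B_2\neq D_1\cup D_2$ or $B_1\cap B_2\neq D_1\cap D_2$.
   Context: A rank $k$ matroid $M$ on ground set $E$ is threshold if there is $w:E\to\mathbb{R}$ such that for every $k$-element $B\subseteq E$, $B$ is a basis of $M$ iff $\sum_{b\in B}w(b)>0$. A non-basis here means a $k$-element subset of $E$ that is not a basis. For sets $A,B$, $A+B$ denotes their multiset union (each element counted with multiplicity equal to the number of the sets containing it).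
   Formalization: The rank k is assumed to be at least 1, since for k = 0 the empty set is a basis of weight 0, so M is never threshold, while (2) and (3) hold vacuously and the equivalence fails. *)

theory Defs
  imports Complex_Main "HOL-Library.Multiset"
begin

locale matroid =
  fixes E :: "'a set" and indep :: "'a set \<Rightarrow> bool"
  assumes finite_ground: "finite E"
    and indep_subset_ground: "indep X \<Longrightarrow> X \<subseteq> E"
    and indep_empty: "indep {}"
    and indep_mono: "indep X \<Longrightarrow> Y \<subseteq> X \<Longrightarrow> indep Y"
    and augmentation: "indep X \<Longrightarrow> indep Y \<Longrightarrow> card X < card Y \<Longrightarrow>
      \<exists>y\<in>Y - X. indep (insert y X)"
begin

definition basis :: "'a set \<Rightarrow> bool" where
  "basis B \<longleftrightarrow> indep B \<and> (\<forall>X. indep X \<longrightarrow> B \<subseteq> X \<longrightarrow> X = B)"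

definition rank :: nat where
  "rank = Max (card ` {X. indep X})"

text \<open>Only subsets of the ground set whose cardinality is the rank count as non-bases.\<close>

definition nonbasis :: "'a set \<Rightarrow> bool" where
  "nonbasis D \<longleftrightarrow> D \<subseteq> E \<and> card D = rank \<and> \<not> basis D"

text \<open>
  Weights are total functions, but only their values on the ground set matter. In rank \<open>0\<close> the empty
  set is a basis of weight \<open>0\<close>, so with the strict inequality no matroid of rank \<open>0\<close> is threshold.
\<close>

definition threshold :: bool where
  "threshold \<longleftrightarrow> (\<exists>w :: 'a \<Rightarrow> real. \<forall>B. B \<subseteq> E \<longrightarrow> card B = rank \<longrightarrow>
     (basis B \<longleftrightarrow> (\<Sum>b\<in>B. w b) > 0))"

definition two_uniform_assumable :: bool where
  "two_uniform_assumable \<longleftrightarrow> (\<forall>B1 B2 D1 D2.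
     basis B1 \<longrightarrow> basis B2 \<longrightarrow> nonbasis D1 \<longrightarrow> nonbasis D2 \<longrightarrow>
     mset_set B1 + mset_set B2 \<noteq> mset_set D1 + mset_set D2)"

end

end

theory Submission
  imports Defs
begin

text \<open>
  If a matroid is 2-uniform assumable, then comparing elements by \<open>x \<le> y\<close> iff replacing \<open>x\<close> by \<open>y\<close>
  never destroys a basis gives a total preorder. List the ground set increasingly and let \<open>M\<close> be the
  greedy basis, taking weak elements first. A \<open>k\<close>-set is a basis iff no prefix of the list contains
  more of its elements than of \<open>M\<close>, and only the prefixes ending just before an element of \<open>M\<close> and
  just after a non-element matter. For two of these prefixes, \<open>P \<subset> Q\<close>, such that \<open>P\<close> contains an
  element of \<open>M\<close> and the complement of \<open>Q\<close> is not contained in \<open>M\<close>, assumability forces \<open>Q - P\<close> to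
  contain just one element of \<open>M\<close> or just one non-element. Hence in any set of prefix constraints
  there is one such that satisfying it strictly implies all the others; giving it a dominating weight
  and recursing on the remaining constraints yields a separating weight function.
\<close>

section \<open>Weights separating families of sets of fixed size\<close>

text \<open>This is the notion of threshold for an arbitrary predicate on \<open>k\<close>-subsets,
  so that the induction over prefix constraints can pass through families not known to consist of
  the bases of a matroid.\<close>

definition separable :: "'a set \<Rightarrow> nat \<Rightarrow> ('a set \<Rightarrow> bool) \<Rightarrow> bool" where
  "separable E k P \<longleftrightarrow> (\<exists>w :: 'a \<Rightarrow> real. \<forall>A. A \<subseteq> E \<longrightarrow> card A = k \<longrightarrow> (P A \<longleftrightarrow> (\<Sum>a\<in>A. w a) > 0))"

lemma separable_cong:
  assumes "\<And>A. A \<subseteq> E \<Longrightarrow> card A = k \<Longrightarrow> P A \<longleftrightarrow> Q A"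
  shows "separable E k P \<longleftrightarrow> separable E k Q"
  unfolding separable_def using assms by (intro ex_cong1) auto

lemma separable_True:
  assumes "k \<ge> 1"
  shows "separable E k (\<lambda>_. True)"
  unfolding separable_def using assms by (intro exI[of _ "\<lambda>_. 1"]) auto

text \<open>The weight \<open>v\<close> compares lexicographically. Over a \<open>k\<close>-set its
  first summand adds up to \<open>C\<close> times the integer
  \<open>\<rho> - card (A \<inter> S)\<close>. Since \<open>C\<close> exceeds every
  \<open>\<bar>sum w A\<bar>\<close>, the old weight decides only when this integer is zero.\<close>

lemma separable_lex:
  fixes E S :: "'a set"
  assumes "finite E" "k \<ge> 1" "separable E k Q"
  shows "separable E k (\<lambda>A. card (A \<inter> S) < \<rho> \<or> card (A \<inter> S) = \<rho> \<and> Q A)"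
proof -
  obtain w :: "'a \<Rightarrow> real"
    where w: "\<And>A. A \<subseteq> E \<Longrightarrow> card A = k \<Longrightarrow> Q A \<longleftrightarrow> (\<Sum>a\<in>A. w a) > 0"
    using assms(3) unfolding separable_def by blast
  define C where "C = 1 + (\<Sum>a\<in>E. \<bar>w a\<bar>)"
  \<comment> \<open>Spreading \<open>\<rho>\<close> evenly over the elements turns a constant
    threshold into a linear weight on sets of size \<open>k\<close>; the division relies on
    \<open>k \<ge> 1\<close>.\<close>
  define v where "v a = C * (\<rho> / k - of_bool (a \<in> S)) + w a" for a
  have "(card (A \<inter> S) < \<rho> \<or> card (A \<inter> S) = \<rho> \<and> Q A) \<longleftrightarrow> (\<Sum>a\<in>A. v a) > 0"
    if A: "A \<subseteq> E" "card A = k" for A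
  proof -
    have fin: "finite A"
      using A assms(1) finite_subset by blast
    have "(\<Sum>a\<in>A. of_bool (a \<in> S)) = real (card (A \<inter> S))"
      using fin by simp
    then have "(\<Sum>a\<in>A. \<rho> / k - of_bool (a \<in> S)) = real \<rho> - real (card (A \<inter> S))"
      using A assms(2) by (simp add: sum_subtractf)
    then have eq: "(\<Sum>a\<in>A. v a) = C * (real \<rho> - real (card (A \<inter> S))) + (\<Sum>a\<in>A. w a)"
      unfolding v_def sum.distrib sum_distrib_left[symmetric] by simp
    have "\<bar>\<Sum>a\<in>A. w a\<bar> \<le> (\<Sum>a\<in>A. \<bar>w a\<bar>)"
      by (rule sum_abs)
    also have "\<dots> \<le> (\<Sum>a\<in>E. \<bar>w a\<bar>)"
      using A assms(1) by (intro sum_mono2) auto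
    finally have bound: "\<bar>\<Sum>a\<in>A. w a\<bar> < C"
      unfolding C_def by simp
    consider "card (A \<inter> S) < \<rho>" | "card (A \<inter> S) = \<rho>" | "card (A \<inter> S) > \<rho>"
      by linarith
    then show ?thesis
    proof cases
      case 1
      then have "C * 1 \<le> C * (real \<rho> - real (card (A \<inter> S)))"
        using bound by (intro mult_left_mono) auto
      then show ?thesis
        using 1 eq bound by simp
    next
      case 2
      then show ?thesis
        using eq w[OF A] by simp
    next
      case 3
      then have "C * (real \<rho> - real (card (A \<inter> S))) \<le> C * (-1)"
        using bound by (intro mult_left_mono) auto
      then show ?thesis
        using 3 eq bound by simp
    qed
  qed
  then show ?thesis
    unfolding separable_def by blast
qed

text \<open>All multiplicities are 0, 1 or 2: the union records where they are positive, the
  intersection where they equal 2. This links conditions (2) and (3).\<close>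

lemma mset_set_add_eq_iff:
  assumes "finite A" "finite B" "finite C" "finite D"
  shows "mset_set A + mset_set B = mset_set C + mset_set D \<longleftrightarrow> A \<union> B = C \<union> D \<and> A \<inter> B = C \<inter> D"
proof -
  have "mset_set A + mset_set B = mset_set C + mset_set D \<longleftrightarrow>
    (\<forall>x. (of_bool (x \<in> A) + of_bool (x \<in> B) :: nat) = of_bool (x \<in> C) + of_bool (x \<in> D))"
    using assms by (simp add: multiset_eq_iff count_mset_set')
  also have "\<dots> \<longleftrightarrow> (\<forall>x. (x \<in> A \<union> B \<longleftrightarrow> x \<in> C \<union> D) \<and> (x \<in> A \<inter> B \<longleftrightarrow> x \<in> C \<inter> D))"
    by (intro all_cong1) (auto simp: of_bool_def)
  finally show ?thesis
    unfolding set_eq_iff by blast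
qed

section \<open>Shifted families of sets of natural numbers\<close>

abbreviation prefix_count :: "nat set \<Rightarrow> nat \<Rightarrow> nat" where
  "prefix_count A i \<equiv> card (A \<inter> {..<i})"

lemma prefix_count_mono: "i \<le> j \<Longrightarrow> prefix_count A i \<le> prefix_count A j"
  by (intro card_mono) auto

lemma prefix_count_split:
  assumes "i \<le> j"
  shows "prefix_count A j = prefix_count A i + card (A \<inter> {i..<j})"
proof -
  have "A \<inter> {..<j} = (A \<inter> {..<i}) \<union> (A \<inter> {i..<j})"
    using assms by auto
  then show ?thesis
    by (metis card_Un_disjoint Int_assoc finite_Int finite_lessThan finite_atLeastLessThan
        inf_bot_right inf_left_commute ivl_disj_int_one(2))
qed

lemma prefix_count_Suc: "prefix_count A (Suc i) = prefix_count A i + of_bool (i \<in> A)"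
  by (simp add: lessThan_Suc)

lemma prefix_count_suffix:
  assumes "finite A"
  shows "prefix_count A i + card (A \<inter> {i..}) = card A"
proof -
  have "A = (A \<inter> {..<i}) \<union> (A \<inter> {i..})"
    by auto
  moreover have "(A \<inter> {..<i}) \<inter> (A \<inter> {i..}) = {}"
    by auto
  ultimately show ?thesis
    using assms by (metis card_Un_disjoint finite_Int)
qed

text \<open>This models the bases once the ground set is replaced by positions
  \<open>0..n-1\<close>, listed from weak to strong: \<open>shift\<close> moves an element to a
  stronger free position, and \<open>M\<close> is the greedy basis.\<close>

locale shifted_family =
  fixes \<B> :: "nat set set" and n k :: nat and M :: "nat set"
  assumes subset: "A \<in> \<B> \<Longrightarrow> A \<subseteq> {..<n}"
    and card_eq: "A \<in> \<B> \<Longrightarrow> card A = k"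
    and shift: "A \<in> \<B> \<Longrightarrow> s \<in> A \<Longrightarrow> t \<notin> A \<Longrightarrow> s < t \<Longrightarrow> t < n \<Longrightarrow> insert t (A - {s}) \<in> \<B>"
    and M_in: "M \<in> \<B>"
    and M_max: "A \<in> \<B> \<Longrightarrow> prefix_count A i \<le> prefix_count M i"
begin

text \<open>Induction on \<open>card (N - A)\<close>: moving the largest element of
  \<open>N - A\<close> to the largest element of \<open>A - N\<close> is a legal shift, keeps the
  domination and brings \<open>N\<close> closer to \<open>A\<close>.\<close>

lemma mem_if_dominated:
  assumes "A \<subseteq> {..<n}" "card A = k" "N \<in> \<B>" "\<And>i. prefix_count A i \<le> prefix_count N i"
  shows "A \<in> \<B>"
  using assms(3,4)
proof (induction "card (N - A)" arbitrary: N rule: less_induct)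
  case less
  have finA: "finite A" and finN: "finite N"
    using assms(1) subset[OF less.prems(1)] finite_subset by blast+
  have cardN: "card N = card A"
    using card_eq less.prems(1) assms(2) by simp
  show ?case
  proof (cases "N = A")
    case True
    then show ?thesis
      using less.prems by simp
  next
    case False
    then have ne: "N - A \<noteq> {}" "A - N \<noteq> {}"
      using finA finN cardN card_subset_eq[of A N] card_subset_eq[of N A] by auto
    define s where "s = Max (N - A)"
    define t where "t = Max (A - N)"
    have s: "s \<in> N" "s \<notin> A" and s_max: "\<And>x. x \<in> N \<Longrightarrow> x > s \<Longrightarrow> x \<in> A"
      using Max_in[of "N - A"] Max_ge[of "N - A"] ne finN unfolding s_def by fastforce+
    have t: "t \<in> A" "t \<notin> N" and t_max: "\<And>x. x \<in> A \<Longrightarrow> x > t \<Longrightarrow> x \<in> N"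
      using Max_in[of "A - N"] Max_ge[of "A - N"] ne finA unfolding t_def by fastforce+
    \<comment> \<open>Otherwise \<open>A\<close> would have fewer elements than \<open>N\<close>
      from \<open>s\<close> on, hence more before \<open>s\<close>, against the domination.\<close>
    have "s < t"
    proof (rule ccontr)
      assume "\<not> s < t"
      then have "t < s"
        using s t by (metis linorder_neqE_nat)
      then have "A \<inter> {s..} \<subset> N \<inter> {s..}"
        using s t_max by fastforce
      then have "card (A \<inter> {s..}) < card (N \<inter> {s..})"
        using finN by (intro psubset_card_mono) auto
      then show False
        using prefix_count_suffix[OF finA, of s] prefix_count_suffix[OF finN, of s] cardN
          less.prems(2)[of s] by simp
    qed
    define N' where "N' = insert t (N - {s})"
    have N': "N' \<in> \<B>"
      unfolding N'_def using shift[OF less.prems(1)] s t \<open>s < t\<close> assms(1) by auto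
    have finN': "finite N'"
      unfolding N'_def using finN by simp
    \<comment> \<open>Up to \<open>s\<close> nothing has changed. Beyond \<open>s\<close> all
      elements of \<open>N'\<close> lie in \<open>A\<close>, so \<open>N'\<close> has no more
      elements than \<open>A\<close> from \<open>i\<close> on, and no fewer before
      \<open>i\<close>.\<close>
    have "prefix_count A i \<le> prefix_count N' i" for i
    proof (cases "i \<le> s")
      case True
      then have "N' \<inter> {..<i} = N \<inter> {..<i}"
        unfolding N'_def using \<open>s < t\<close> by auto
      then show ?thesis
        using less.prems(2)[of i] by simp
    next
      case False
      then have "N' \<inter> {i..} \<subseteq> A \<inter> {i..}"
        unfolding N'_def using s_max t by auto
      then have "card (N' \<inter> {i..}) \<le> card (A \<inter> {i..})"
        using finA by (intro card_mono) auto
      then show ?thesis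
        using prefix_count_suffix[OF finA, of i] prefix_count_suffix[OF finN', of i]
          card_eq[OF N'] assms(2) by simp
    qed
    moreover have "card (N' - A) < card (N - A)"
    proof -
      have "N' - A \<subset> N - A"
        unfolding N'_def using s t by auto
      then show ?thesis
        using finN by (intro psubset_card_mono) auto
    qed
    ultimately show ?thesis
      using less.hyps N' by blast
  qed
qed

section \<open>Essential prefixes\<close>

text \<open>The index \<open>i\<close> is the last position of the prefix, so its constraint
  concerns \<open>{..<Suc i}\<close>.\<close>

definition essential :: "nat set" where
  "essential = {i. i \<notin> M \<and> Suc i \<in> M}"

lemma finite_M: "finite M"
  using subset[OF M_in] finite_subset by blast

lemma essential_less: "i \<in> essential \<Longrightarrow> Suc i < n"
  unfolding essential_def using subset[OF M_in] by auto

lemma finite_essential: "finite essential"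
  by (rule finite_subset[of _ "{..<n}"]) (auto dest: essential_less)

text \<open>Consider the shortest violated prefix. Its last position \<open>p\<close> is not in
  \<open>M\<close>. Up to the next element \<open>m\<close> of \<open>M\<close> the count of
  \<open>M\<close> stays constant while that of \<open>A\<close> cannot drop, so the violation
  persists at the essential prefix ending just before \<open>m\<close>.\<close>

lemma mem_iff_essential:
  assumes "A \<subseteq> {..<n}" "card A = k"
  shows "A \<in> \<B> \<longleftrightarrow> (\<forall>i\<in>essential. prefix_count A (Suc i) \<le> prefix_count M (Suc i))"
proof
  assume ess: "\<forall>i\<in>essential. prefix_count A (Suc i) \<le> prefix_count M (Suc i)"
  show "A \<in> \<B>"
  proof (rule ccontr)
    assume "A \<notin> \<B>"
    then have ex: "\<exists>i. prefix_count A i > prefix_count M i"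
      using mem_if_dominated[OF assms M_in] not_less by blast
    define i where "i = (LEAST i. prefix_count A i > prefix_count M i)"
    have i: "prefix_count A i > prefix_count M i"
      unfolding i_def using ex by (rule LeastI_ex)
    have i_min: "prefix_count A j \<le> prefix_count M j" if "j < i" for j
      using not_less_Least[of j "\<lambda>i. prefix_count A i > prefix_count M i"] that
      unfolding i_def by simp
    obtain p where p: "i = Suc p"
      using i by (cases i) auto
    have "p \<notin> M"
      using i i_min[of p] unfolding p prefix_count_Suc by (auto simp: of_bool_def split: if_splits)
    \<comment> \<open>Without a later element the prefix would contain all \<open>k\<close> elements
      of \<open>M\<close>, and \<open>A\<close> has no more than \<open>k\<close>.\<close>
    have "\<exists>m. m \<in> M \<and> p < m"
    proof (rule ccontr)
      assume "\<not> ?thesis"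
      then have "M \<inter> {..<i} = M"
        unfolding p by (auto simp: less_Suc_eq_le not_less)
      then have "prefix_count M i = k"
        using card_eq[OF M_in] by simp
      moreover have "prefix_count A i \<le> k"
        using assms finite_subset[OF assms(1)] card_mono[of A "A \<inter> {..<i}"] by auto
      ultimately show False
        using i by simp
    qed
    define m where "m = (LEAST m. m \<in> M \<and> p < m)"
    have m: "m \<in> M" "p < m"
      unfolding m_def using LeastI_ex[OF \<open>\<exists>m. m \<in> M \<and> p < m\<close>] by auto
    have m_min: "j \<notin> M" if "p < j" "j < m" for j
      using not_less_Least[of j "\<lambda>m. m \<in> M \<and> p < m"] that unfolding m_def by blast
    obtain q where q: "m = Suc q"
      using m by (cases m) auto
    have "q \<notin> M"
      using m_min[of q] \<open>p \<notin> M\<close> m q by (cases "q = p") auto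
    then have "q \<in> essential"
      unfolding essential_def using m q by simp
    moreover have "M \<inter> {i..<m} = {}"
      using m_min p by auto
    then have "prefix_count M m = prefix_count M i"
      using prefix_count_split[of i m M] m p by simp
    moreover have "prefix_count A i \<le> prefix_count A m"
      using m p by (intro prefix_count_mono) simp
    ultimately show False
      using ess i q by force
  qed
qed (use M_max in blast)

end

section \<open>Dominating prefixes in assumable families\<close>

locale assumable_shifted_family = shifted_family +
  assumes assumable: "B1 \<in> \<B> \<Longrightarrow> B2 \<in> \<B> \<Longrightarrow> D1 \<subseteq> {..<n} \<Longrightarrow> card D1 = k \<Longrightarrow> D1 \<notin> \<B> \<Longrightarrow>
      D2 \<subseteq> {..<n} \<Longrightarrow> card D2 = k \<Longrightarrow> D2 \<notin> \<B> \<Longrightarrow>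
      B1 \<union> B2 = D1 \<union> D2 \<Longrightarrow> B1 \<inter> B2 = D1 \<inter> D2 \<Longrightarrow> False"
begin

text \<open>Otherwise there are a second element \<open>s\<close> of \<open>M\<close> and a second
  non-element \<open>t\<close> between the two prefix ends, with
  \<open>x < i < Suc i < s, t < j < Suc j < z\<close>. Two members and two non-members with the same
  union and intersection can then be built by exchanging these elements in two copies of
  \<open>M\<close>.\<close>

lemma essential_pair:
  assumes i: "i \<in> essential" and j: "j \<in> essential" and "i < j"
    and x: "x \<in> M" "x < i" and z: "z \<notin> M" "j < z" "z < n"
  shows "M \<inter> {Suc i..<Suc j} = {Suc i} \<or> {Suc i..<Suc j} - M = {j}"
proof (rule ccontr)
  assume contr: "\<not> ?thesis"
  have ij: "i \<notin> M" "Suc i \<in> M" "j \<notin> M" "Suc j \<in> M"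
    using i j unfolding essential_def by auto
  have bounds: "Suc i < n" "Suc j < n"
    using i j essential_less by auto
  have "Suc i \<noteq> j"
    using ij by auto
  then have "Suc i < j"
    using \<open>i < j\<close> by simp
  obtain s where s: "s \<in> M" "Suc i < s" "s \<le> j"
  proof -
    have "Suc i \<in> M \<inter> {Suc i..<Suc j}"
      using ij \<open>i < j\<close> by auto
    with contr obtain s where "s \<in> M \<inter> {Suc i..<Suc j}" "s \<noteq> Suc i"
      by blast
    then show ?thesis
      using that by auto
  qed
  obtain t where t: "t \<notin> M" "Suc i < t" "t < j"
  proof -
    have "j \<in> {Suc i..<Suc j} - M"
      using ij \<open>i < j\<close> by auto
    with contr obtain t where "t \<in> {Suc i..<Suc j} - M" "t \<noteq> j"
      by blast
    then show ?thesis
      using that ij by (metis DiffD1 DiffD2 atLeastLessThan_iff le_neq_implies_less less_Suc_eq)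
  qed
  have "s < j"
    using s ij by (metis le_neq_implies_less)
  have "z \<noteq> Suc j"
    using z ij by auto
  then have "Suc j < z"
    using z by simp
  \<comment> \<open>Only right shifts of \<open>M\<close> are used: \<open>x\<close> to
    \<open>i\<close> for \<open>B1\<close>; \<open>Suc j\<close> to \<open>z\<close>,
    \<open>s\<close> to \<open>j\<close> and \<open>Suc i\<close> to \<open>t\<close> for
    \<open>B2\<close>. The sets \<open>D1\<close> and \<open>D2\<close> distribute the same removals
    and insertions differently. Up to \<open>i\<close>, \<open>D1\<close> gains \<open>i\<close> and
    loses nothing; up to \<open>j\<close>, \<open>D2\<close> gains \<open>t\<close> and
    \<open>j\<close> and loses only \<open>x\<close>. So each exceeds \<open>M\<close> on an
    essential prefix.\<close>
  define B1 where "B1 = insert i (M - {x})"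
  define B2 where "B2 = insert t (insert j (insert z (M - {Suc j}) - {s}) - {Suc i})"
  define D1 where "D1 = insert i (insert z (M - {Suc i, s}))"
  define D2 where "D2 = insert t (insert j (M - {x, Suc j}))"
  have B1: "B1 \<in> \<B>"
    unfolding B1_def using M_in x ij bounds by (intro shift) auto
  have "insert z (M - {Suc j}) \<in> \<B>"
    using M_in ij z \<open>Suc j < z\<close> by (intro shift) auto
  then have "insert j (insert z (M - {Suc j}) - {s}) \<in> \<B>"
    by (rule shift) (use ij s z \<open>s < j\<close> bounds in auto)
  then have B2: "B2 \<in> \<B>"
    unfolding B2_def by (rule shift) (use ij s t z \<open>s < j\<close> \<open>i < j\<close> bounds in auto)
  have M: "M \<subseteq> {..<n}" "card M = k"
    using subset card_eq M_in by auto
  have D1: "D1 \<subseteq> {..<n}" "D2 \<subseteq> {..<n}"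
    unfolding D1_def D2_def using M z t bounds by auto
  have "card {Suc i, s} = 2" "card {x, Suc j} = 2"
    using s x \<open>i < j\<close> by auto
  moreover have "card {Suc i, s} \<le> card M" "card {x, Suc j} \<le> card M"
    using finite_M s x ij by (intro card_mono; simp)+
  \<comment> \<open>The bound \<open>k \<ge> 2\<close> is recorded because subtraction on
    \<open>nat\<close> truncates, and two insertions must restore the size \<open>k\<close>.\<close>
  ultimately have "card (M - {Suc i, s}) = k - 2" "card (M - {x, Suc j}) = k - 2" "k \<ge> 2"
    using M s x ij card_Diff_subset[of "{Suc i, s}" M] card_Diff_subset[of "{x, Suc j}" M] by auto
  then have cards: "card D1 = k" "card D2 = k"
    unfolding D1_def D2_def using finite_M ij z t \<open>i < j\<close> by auto
  have "D1 \<inter> {..<Suc i} = insert i (M \<inter> {..<Suc i})"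
    unfolding D1_def using s z \<open>i < j\<close> by auto
  then have "prefix_count D1 (Suc i) = Suc (prefix_count M (Suc i))"
    using ij by simp
  then have D1_notin: "D1 \<notin> \<B>"
    using M_max[of D1 "Suc i"] by auto
  have "D2 \<inter> {..<Suc j} = insert t (insert j (M \<inter> {..<Suc j} - {x}))"
    unfolding D2_def using t by auto
  moreover have "Suc (card (M \<inter> {..<Suc j} - {x})) = prefix_count M (Suc j)"
    using x \<open>i < j\<close> by (intro card_Suc_Diff1) auto
  ultimately have "prefix_count D2 (Suc j) = Suc (prefix_count M (Suc j))"
    using ij t by simp
  then have D2_notin: "D2 \<notin> \<B>"
    using M_max[of D2 "Suc j"] by auto
  have "B1 \<union> B2 = D1 \<union> D2" "B1 \<inter> B2 = D1 \<inter> D2"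
    unfolding B1_def B2_def D1_def D2_def
    using ij s t x z \<open>i < j\<close> \<open>s < j\<close> by auto
  then show False
    using assumable B1 B2 D1 cards D1_notin D2_notin by blast
qed

text \<open>One of the two extreme indices of \<open>J\<close> always works. Either strictness at
  one of them is impossible, or they coincide, or \<open>essential_pair\<close> shows that the
  stretch between them is so nearly disjoint from \<open>M\<close>, or so nearly contained in it,
  that a slack of one at an end suffices.\<close>

lemma exists_dominating_prefix:
  assumes "J \<subseteq> essential" "J \<noteq> {}"
  obtains i where "i \<in> J"
    "\<And>A l. A \<subseteq> {..<n} \<Longrightarrow> card A = k \<Longrightarrow> prefix_count A (Suc i) < prefix_count M (Suc i) \<Longrightarrow>
      l \<in> J \<Longrightarrow> prefix_count A (Suc l) \<le> prefix_count M (Suc l)"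
proof -
  have "finite J"
    using assms finite_essential finite_subset by blast
  define i where "i = Min J"
  define j where "j = Max J"
  have iJ: "i \<in> J" "i \<in> essential" and jJ: "j \<in> J" "j \<in> essential"
    unfolding i_def j_def using assms \<open>finite J\<close> Min_in Max_in by blast+
  have between: "i \<le> l" "l \<le> j" if "l \<in> J" for l
    unfolding i_def j_def using \<open>finite J\<close> that by auto
  have "i < n" "j < n"
    using iJ jJ essential_less Suc_lessD by blast+
  consider "prefix_count M (Suc i) = 0" | "{Suc j..<n} \<subseteq> M" | "i = j"
    | "M \<inter> {Suc i..<Suc j} = {Suc i}" | "{Suc i..<Suc j} - M = {j}" "i < j"
  proof (cases "prefix_count M (Suc i) = 0 \<or> {Suc j..<n} \<subseteq> M \<or> i = j")
    case False
    then have "M \<inter> {..<Suc i} \<noteq> {}" "\<not> {Suc j..<n} \<subseteq> M"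
      by auto
    then obtain x z where "x \<in> M" "x < Suc i" "z \<notin> M" "z \<in> {Suc j..<n}"
      by blast
    moreover have "x \<noteq> i"
      using \<open>x \<in> M\<close> iJ unfolding essential_def by auto
    moreover have "i < j"
      using False between[OF jJ(1)] by auto
    ultimately show ?thesis
      using essential_pair[OF iJ(2) jJ(2), of x z] that by force
  qed (use that in blast)
  then show ?thesis
  proof cases
    case 1
    then show ?thesis
      using that[OF iJ(1)] by simp
  next
    case 2
    \<comment> \<open>\<open>M\<close> fills all positions after \<open>j\<close>, so
      \<open>A\<close> cannot have more elements there, nor fewer than \<open>M\<close> before. The
      required implication is vacuous.\<close>
    have "\<not> prefix_count A (Suc j) < prefix_count M (Suc j)" if A: "A \<subseteq> {..<n}" "card A = k" for A
    proof -
      have "A \<inter> {Suc j..} \<subseteq> M \<inter> {Suc j..}"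
        using A(1) 2 by fastforce
      then have "card (A \<inter> {Suc j..}) \<le> card (M \<inter> {Suc j..})"
        using finite_M by (intro card_mono) auto
      then show ?thesis
        using prefix_count_suffix[OF finite_M, of "Suc j"] card_eq[OF M_in]
          prefix_count_suffix[OF finite_subset[OF A(1) finite_lessThan], of "Suc j"] A by simp
    qed
    then show ?thesis
      using that[OF jJ(1)] by blast
  next
    case 3
    then have "l = i" if "l \<in> J" for l
      using between[OF that] by simp
    then show ?thesis
      using that[OF iJ(1)] by (metis less_imp_le)
  next
    case 4
    \<comment> \<open>\<open>M\<close> gains a single element between the ends, so a slack of one at
      \<open>j\<close> brings the count of \<open>A\<close> down to that of \<open>M\<close> at
      \<open>i\<close>; monotonicity covers every \<open>l\<close> in between.\<close>
    have "prefix_count A (Suc l) \<le> prefix_count M (Suc l)"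
      if "prefix_count A (Suc j) < prefix_count M (Suc j)" "l \<in> J" for A l
    proof -
      have "prefix_count A (Suc l) \<le> prefix_count A (Suc j)"
        using between that by (intro prefix_count_mono) simp
      also have "\<dots> < prefix_count M (Suc j)"
        by fact
      also have "\<dots> = Suc (prefix_count M (Suc i))"
        using prefix_count_split[of "Suc i" "Suc j" M] 4 between[OF jJ(1)] by simp
      also have "\<dots> \<le> Suc (prefix_count M (Suc l))"
        using prefix_count_mono[of "Suc i" "Suc l" M] between that by simp
      finally show ?thesis
        by simp
    qed
    then show ?thesis
      using that[OF jJ(1)] by blast
  next
    case 5
    \<comment> \<open>Between the ends \<open>M\<close> misses only \<open>j\<close>, so after
      \<open>i\<close> the set \<open>A\<close> can gain at most one element more than
      \<open>M\<close>, which the slack at \<open>i\<close> absorbs.\<close>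
    have "prefix_count A (Suc l) \<le> prefix_count M (Suc l)"
      if "prefix_count A (Suc i) < prefix_count M (Suc i)" "l \<in> J" for A l
    proof -
      have il: "Suc i \<le> Suc l"
        using between that by simp
      have "{Suc i..<Suc l} \<subseteq> insert j (M \<inter> {Suc i..<Suc l})"
        using 5 between(2)[OF that(2)] by fastforce
      then have "card {Suc i..<Suc l} \<le> card (insert j (M \<inter> {Suc i..<Suc l}))"
        by (intro card_mono) auto
      also have "\<dots> \<le> Suc (card (M \<inter> {Suc i..<Suc l}))"
        by (rule card_insert_le_m1) simp_all
      finally have "card {Suc i..<Suc l} \<le> Suc (card (M \<inter> {Suc i..<Suc l}))" .
      moreover have "card (A \<inter> {Suc i..<Suc l}) \<le> card {Suc i..<Suc l}"
        by (intro card_mono) auto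
      ultimately show ?thesis
        using prefix_count_split[OF il, of A] prefix_count_split[OF il, of M] that(1) by simp
    qed
    then show ?thesis
      using that[OF iJ(1)] by blast
  qed
qed

text \<open>For a dominating \<open>i\<close>, the constraints in \<open>J\<close> hold iff the one
  at \<open>i\<close> is strict, or it is tight and those in \<open>J - {i}\<close> hold. This is
  the form handled by \<open>separable_lex\<close>.\<close>

lemma separable_prefixes:
  assumes "k \<ge> 1" "J \<subseteq> essential"
  shows "separable {..<n} k (\<lambda>A. \<forall>i\<in>J. prefix_count A (Suc i) \<le> prefix_count M (Suc i))"
proof -
  have "finite J"
    using assms finite_essential finite_subset by blast
  then show ?thesis
    using assms(2)
  proof (induction J rule: finite_psubset_induct)
    case (psubset J)
    show ?case
    proof (cases "J = {}")
      case True
      then show ?thesis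
        using separable_True[OF assms(1)] by simp
    next
      case False
      obtain i where i: "i \<in> J"
        "\<And>A l. A \<subseteq> {..<n} \<Longrightarrow> card A = k \<Longrightarrow> prefix_count A (Suc i) < prefix_count M (Suc i) \<Longrightarrow>
          l \<in> J \<Longrightarrow> prefix_count A (Suc l) \<le> prefix_count M (Suc l)"
        using exists_dominating_prefix[OF psubset.prems False] by blast
      let ?Q = "\<lambda>J A. \<forall>i\<in>J. prefix_count A (Suc i) \<le> prefix_count M (Suc i)"
      have "separable {..<n} k (?Q (J - {i}))"
        using psubset i(1) by (intro psubset.IH) auto
      then have "separable {..<n} k (\<lambda>A. prefix_count A (Suc i) < prefix_count M (Suc i) \<or>
          prefix_count A (Suc i) = prefix_count M (Suc i) \<and> ?Q (J - {i}) A)"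
        using assms(1) by (intro separable_lex) auto
      then show ?thesis
      proof (rule iffD1[OF separable_cong, rotated])
        fix A assume A: "A \<subseteq> {..<n}" "card A = k"
        show "(prefix_count A (Suc i) < prefix_count M (Suc i) \<or>
          prefix_count A (Suc i) = prefix_count M (Suc i) \<and> ?Q (J - {i}) A) \<longleftrightarrow> ?Q J A"
          using i(1) i(2)[OF A] by (metis DiffI Diff_iff le_eq_less_or_eq singletonD)
      qed
    qed
  qed
qed

theorem separable_family:
  assumes "k \<ge> 1"
  shows "separable {..<n} k (\<lambda>A. A \<in> \<B>)"
  using separable_prefixes[OF assms subset_refl]
    separable_cong[of "{..<n}" k "\<lambda>A. A \<in> \<B>", OF mem_iff_essential] by blast

end

section \<open>Matroids\<close>

context matroid
begin

section \<open>Bases and rank\<close>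

lemma finite_indep: "indep X \<Longrightarrow> finite X"
  using indep_subset_ground finite_ground finite_subset by blast

lemma finite_indep_cards: "finite (card ` {X. indep X})"
proof -
  have "{X. indep X} \<subseteq> Pow E"
    using indep_subset_ground by blast
  then show ?thesis
    using finite_ground finite_subset by blast
qed

lemma card_indep_le_rank: "indep X \<Longrightarrow> card X \<le> rank"
  unfolding rank_def using finite_indep_cards by (intro Max_ge) auto

lemma exists_indep_rank: "\<exists>X. indep X \<and> card X = rank"
proof -
  have "rank \<in> card ` {X. indep X}"
    unfolding rank_def using finite_indep_cards indep_empty by (intro Max_in) auto
  then show ?thesis
    by auto
qed

lemma basis_iff: "basis B \<longleftrightarrow> indep B \<and> card B = rank"
proof
  assume B: "basis B"
  obtain X where X: "indep X" "card X = rank"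
    using exists_indep_rank by blast
  have "\<not> card B < card X"
  proof
    assume "card B < card X"
    then obtain y where "y \<in> X - B" "indep (insert y B)"
      using augmentation B X unfolding basis_def by blast
    then show False
      using B unfolding basis_def by blast
  qed
  then show "indep B \<and> card B = rank"
    using B X card_indep_le_rank[of B] unfolding basis_def by auto
next
  assume B: "indep B \<and> card B = rank"
  then have "X = B" if "indep X" "B \<subseteq> X" for X
    using that card_indep_le_rank[of X] finite_indep[of X] by (metis card_seteq)
  then show "basis B"
    using B unfolding basis_def by blast
qed

section \<open>The greedy basis\<close>

text \<open>The greedy set is optimal on all prefixes at once. Accepting an element raises its count
  by one, the most any competitor can gain. After a rejection, a better competitor would augment the
  greedy set inside an earlier prefix where it is already optimal.\<close>

lemma greedy_indep:
  "\<exists>X. indep X \<and> X \<subseteq> set (take i xs) \<and>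
     (\<forall>j\<le>i. \<forall>Y. indep Y \<longrightarrow> card (Y \<inter> set (take j xs)) \<le> card (X \<inter> set (take j xs)))"
proof (induction i)
  case 0
  then show ?case
    using indep_empty by auto
next
  case (Suc i)
  let ?P = "\<lambda>j. set (take j xs)"
  obtain X where X: "indep X" "X \<subseteq> ?P i"
    "\<And>j Y. j \<le> i \<Longrightarrow> indep Y \<Longrightarrow> card (Y \<inter> ?P j) \<le> card (X \<inter> ?P j)"
    using Suc by blast
  have finX: "finite X"
    using X finite_indep by blast
  have XP: "X \<inter> ?P i = X"
    using X by blast
  show ?case
  proof (cases "i < length xs")
    case False
    then have "?P (Suc i) = ?P i"
      by simp
    then show ?thesis
      using X by (intro exI[of _ X]) (auto simp: le_Suc_eq)
  next
    case True
    let ?e = "xs ! i"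
    have PS: "?P (Suc i) = insert ?e (?P i)"
      using True by (simp add: take_Suc_conv_app_nth)
    show ?thesis
    proof (cases "?e \<notin> ?P i \<and> indep (insert ?e X)")
      case e: True
      have "card (Y \<inter> ?P j) \<le> card (insert ?e X \<inter> ?P j)" if "j \<le> Suc i" "indep Y" for j Y
      proof (cases "j \<le> i")
        case True
        have "card (Y \<inter> ?P j) \<le> card (X \<inter> ?P j)"
          using X(3) True that by blast
        also have "\<dots> \<le> card (insert ?e X \<inter> ?P j)"
          by (intro card_mono) auto
        finally show ?thesis .
      next
        case False
        then have j: "j = Suc i"
          using that by simp
        have "card (Y \<inter> ?P j) \<le> card (insert ?e (Y \<inter> ?P i))"
          unfolding j PS by (intro card_mono) auto
        also have "\<dots> \<le> Suc (card (Y \<inter> ?P i))"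
          by (rule card_insert_le_m1) simp_all
        also have "\<dots> \<le> Suc (card X)"
          using X(3)[of i Y] that XP by simp
        also have "\<dots> = card (insert ?e X)"
          using e X(2) finX by (subst card_insert_disjoint) auto
        also have "insert ?e X = insert ?e X \<inter> ?P j"
          unfolding j PS using X(2) by auto
        finally show ?thesis .
      qed
      then show ?thesis
        using e X(2) PS by (intro exI[of _ "insert ?e X"]) auto
    next
      case e: False
      have "card (Y \<inter> ?P j) \<le> card (X \<inter> ?P j)" if "j \<le> Suc i" "indep Y" for j Y
      proof (cases "j \<le> i")
        case False
        then have j: "j = Suc i"
          using that by simp
        have XPj: "X \<inter> ?P j = X"
          unfolding j PS using X(2) by auto
        show ?thesis
        proof (rule ccontr)
          assume "\<not> ?thesis"
          then have "card X < card (Y \<inter> ?P j)"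
            using XPj by simp
          moreover have "indep (Y \<inter> ?P j)"
            using that indep_mono by blast
          ultimately obtain y where y: "y \<in> Y \<inter> ?P j - X" "indep (insert y X)"
            using augmentation[OF X(1)] by blast
          \<comment> \<open>If \<open>y\<close> is the new element \<open>?e\<close>, then
            \<open>insert ?e X\<close> is independent, so \<open>?e\<close> was passed over only
            because it already occurs in the earlier prefix.\<close>
          have "y \<in> ?P i"
            using y e unfolding j PS by auto
          then have "insert y X \<inter> ?P i = insert y X"
            using X(2) by auto
          then have "card (insert y X) \<le> card X"
            using X(3)[of i "insert y X"] y XP by simp
          then show False
            using y finX by simp
        qed
      qed (use X(3) that in blast)
      then show ?thesis
        using X PS by (intro exI[of _ X]) auto
    qed
  qed
qed

section \<open>Assumability as a condition on unions and intersections\<close>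

definition assumable :: bool where
  "assumable \<longleftrightarrow> (\<forall>B1 B2 D1 D2. basis B1 \<longrightarrow> basis B2 \<longrightarrow> nonbasis D1 \<longrightarrow> nonbasis D2 \<longrightarrow>
     B1 \<union> B2 \<noteq> D1 \<union> D2 \<or> B1 \<inter> B2 \<noteq> D1 \<inter> D2)"

lemma assumableD:
  assumes "assumable" "basis B1" "basis B2" "D1 \<subseteq> E" "D2 \<subseteq> E" "card D1 = rank" "card D2 = rank"
    "B1 \<union> B2 = D1 \<union> D2" "B1 \<inter> B2 = D1 \<inter> D2"
  shows "basis D1 \<or> basis D2"
  using assms unfolding assumable_def nonbasis_def by blast

lemma basis_subset: "basis B \<Longrightarrow> B \<subseteq> E"
  unfolding basis_def using indep_subset_ground by blast

lemma basis_finite: "basis B \<Longrightarrow> finite B"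
  unfolding basis_def using finite_indep by blast

lemma basis_card: "basis B \<Longrightarrow> card B = rank"
  using basis_iff by blast

lemma two_uniform_assumable_iff: "two_uniform_assumable \<longleftrightarrow> assumable"
proof -
  have "finite D" if "nonbasis D" for D
    using that finite_ground finite_subset unfolding nonbasis_def by blast
  then show ?thesis
    unfolding two_uniform_assumable_def assumable_def
    by (metis basis_finite mset_set_add_eq_iff)
qed

text \<open>The total weight of two sets depends only on their union and intersection. It is
  positive for two bases and at most zero for two non-bases.\<close>

lemma assumable_if_threshold:
  assumes threshold
  shows assumable
proof -
  obtain w :: "'a \<Rightarrow> real"
    where w: "\<And>B. B \<subseteq> E \<Longrightarrow> card B = rank \<Longrightarrow> basis B \<longleftrightarrow> (\<Sum>b\<in>B. w b) > 0"
    using assms unfolding threshold_def by blast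
  show ?thesis
    unfolding assumable_def
  proof (intro allI impI)
    fix B1 B2 D1 D2
    assume B: "basis B1" "basis B2" and D: "nonbasis D1" "nonbasis D2"
    have fin: "finite B1" "finite B2" "finite D1" "finite D2"
      using B D basis_finite finite_ground finite_subset unfolding nonbasis_def by blast+
    have "sum w B1 > 0" "sum w B2 > 0"
      using B w basis_subset basis_card by blast+
    moreover have "\<not> sum w D1 > 0" "\<not> sum w D2 > 0"
      using D w unfolding nonbasis_def by blast+
    ultimately have "sum w B1 + sum w B2 \<noteq> sum w D1 + sum w D2"
      by linarith
    then show "B1 \<union> B2 \<noteq> D1 \<union> D2 \<or> B1 \<inter> B2 \<noteq> D1 \<inter> D2"
      using fin by (metis sum.union_inter)
  qed
qed

section \<open>The exchange preorder\<close>

text \<open>This is the analogue for bases of the desirability relation of simple games.\<close>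

definition weaker :: "'a \<Rightarrow> 'a \<Rightarrow> bool" where
  "weaker x y \<longleftrightarrow> (\<forall>S. basis S \<longrightarrow> x \<in> S \<longrightarrow> y \<notin> S \<longrightarrow> basis (insert y (S - {x})))"

lemma weaker_refl: "weaker x x"
  unfolding weaker_def by blast

text \<open>The exchange of \<open>x\<close> for \<open>z\<close> passes through \<open>y\<close>.
  If \<open>y\<close> is in \<open>S\<close>, then \<open>y\<close> first makes way for
  \<open>z\<close> and afterwards replaces \<open>x\<close>; otherwise \<open>y\<close> first
  replaces \<open>x\<close> and then makes way for \<open>z\<close>.\<close>

lemma weaker_trans:
  assumes xy: "weaker x y" and yz: "weaker y z"
  shows "weaker x z"
  unfolding weaker_def
proof (intro allI impI)
  fix S assume S: "basis S" "x \<in> S" "z \<notin> S"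
  consider "x = y" | "y = z" | "x \<noteq> y" "y \<noteq> z" "y \<in> S" | "x \<noteq> y" "y \<noteq> z" "y \<notin> S"
    by blast
  then show "basis (insert z (S - {x}))"
  proof cases
    case 3
    then have "basis (insert z (S - {y}))"
      using yz S unfolding weaker_def by blast
    then have "basis (insert y (insert z (S - {y}) - {x}))"
      using xy S 3 unfolding weaker_def by blast
    moreover have "insert y (insert z (S - {y}) - {x}) = insert z (S - {x})"
      using S 3 by auto
    ultimately show ?thesis
      by simp
  next
    case 4
    then have "basis (insert y (S - {x}))"
      using xy S unfolding weaker_def by blast
    then have "basis (insert z (insert y (S - {x}) - {y}))"
      using yz S 4 unfolding weaker_def by blast
    moreover have "insert z (insert y (S - {x}) - {y}) = insert z (S - {x})"
      using S 4 by auto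
    ultimately show ?thesis
      by simp
  qed (use assms S in \<open>auto simp: weaker_def\<close>)
qed

text \<open>If both comparisons failed, with witnesses \<open>S\<close> and \<open>T\<close>,
  trading \<open>x\<close> for \<open>y\<close> between these two bases would give two non-bases
  with the same union and intersection.\<close>

lemma weaker_total:
  assumes assumable "x \<in> E" "y \<in> E"
  shows "weaker x y \<or> weaker y x"
proof (rule ccontr)
  assume "\<not> ?thesis"
  then obtain S T where S: "basis S" "x \<in> S" "y \<notin> S" "\<not> basis (insert y (S - {x}))"
    and T: "basis T" "y \<in> T" "x \<notin> T" "\<not> basis (insert x (T - {y}))"
    unfolding weaker_def by blast
  have "card (insert y (S - {x})) = rank" "card (insert x (T - {y})) = rank"
    using S T basis_card basis_finite
    by (metis Diff_iff card_Suc_Diff1 card_insert_disjoint finite_Diff)+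
  moreover have "insert y (S - {x}) \<subseteq> E" "insert x (T - {y}) \<subseteq> E"
    using S T basis_subset assms by blast+
  moreover have "S \<union> T = insert y (S - {x}) \<union> insert x (T - {y})"
    "S \<inter> T = insert y (S - {x}) \<inter> insert x (T - {y})"
    using S T by auto
  ultimately have "basis (insert y (S - {x})) \<or> basis (insert x (T - {y}))"
    by (intro assumableD[OF assms(1) S(1) T(1)])
  then show False
    using S T by simp
qed

text \<open>Sorting by the number \<open>f\<close> of weaker elements linearizes the total preorder:
  if \<open>x\<close> is not weaker than \<open>y\<close>, then the elements weaker than
  \<open>y\<close> form a proper subset of those weaker than \<open>x\<close>, which also contains
  \<open>x\<close> itself.\<close>

lemma sorted_ground:
  assumes assumable
  obtains xs where "set xs = E" "distinct xs"
    "\<And>i j. i < j \<Longrightarrow> j < length xs \<Longrightarrow> weaker (xs ! i) (xs ! j)"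
proof -
  define f where "f y = card {x \<in> E. weaker x y}" for y
  have weaker_if: "weaker x y" if "x \<in> E" "y \<in> E" "f x \<le> f y" for x y
  proof (rule ccontr)
    assume not: "\<not> weaker x y"
    then have "weaker y x"
      using weaker_total assms that by blast
    then have "{z \<in> E. weaker z y} \<subset> {z \<in> E. weaker z x}"
      using not weaker_trans weaker_refl that by blast
    then have "f y < f x"
      unfolding f_def using finite_ground by (intro psubset_card_mono) auto
    then show False
      using that by simp
  qed
  obtain ys where ys: "set ys = E" "distinct ys"
    using finite_distinct_list finite_ground by blast
  define xs where "xs = sort_key f ys"
  have xs: "set xs = E" "distinct xs"
    unfolding xs_def using ys by auto
  have "weaker (xs ! i) (xs ! j)" if "i < j" "j < length xs" for i j
  proof (rule weaker_if)
    show "xs ! i \<in> E" "xs ! j \<in> E"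
      using xs that nth_mem[of i xs] nth_mem[of j xs] by auto
    have "sorted (map f xs)"
      unfolding xs_def by simp
    then show "f (xs ! i) \<le> f (xs ! j)"
      using that sorted_nth_mono[of "map f xs" i j] by simp
  qed
  then show ?thesis
    using that xs by blast
qed

section \<open>Transfer to positions and construction of the weights\<close>

text \<open>The map \<open>\<phi>\<close> from positions to elements carries the sorted matroid to
  an assumable shifted family, and the weights found there are carried back by its inverse.\<close>

lemma threshold_if_assumable:
  assumes "assumable" "rank \<ge> 1"
  shows threshold
proof -
  obtain xs where xs: "set xs = E" "distinct xs"
    "\<And>i j. i < j \<Longrightarrow> j < length xs \<Longrightarrow> weaker (xs ! i) (xs ! j)"
    using sorted_ground[OF assms(1)] by blast
  define n where "n = length xs"
  define \<phi> where "\<phi> = (!) xs"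
  define \<B> where "\<B> = {A. A \<subseteq> {..<n} \<and> basis (\<phi> ` A)}"
  have inj: "inj_on \<phi> {..<n}"
    unfolding \<phi>_def n_def using xs(2) by (simp add: inj_on_nth)
  have inj_sub: "inj_on \<phi> A" if "A \<subseteq> {..<n}" for A
    using inj that inj_on_subset by blast
  have card_img: "card (\<phi> ` A) = card A" if "A \<subseteq> {..<n}" for A
    using inj_sub[OF that] by (rule card_image)
  have prefix_img: "\<phi> ` {..<i} = set (take i xs)" if "i \<le> n" for i
    using nth_image[of i xs] that unfolding \<phi>_def n_def lessThan_atLeast0 by simp
  have img_E: "\<phi> ` {..<n} = E"
    using prefix_img[of n] xs(1) unfolding n_def by simp
  obtain X where X: "indep X" "\<And>j Y. j \<le> n \<Longrightarrow> indep Y \<Longrightarrow>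
      card (Y \<inter> set (take j xs)) \<le> card (X \<inter> set (take j xs))"
    using greedy_indep[of n xs] by blast
  \<comment> \<open>The prefix of length \<open>n\<close> is all of \<open>E\<close>, so optimality
    there makes \<open>X\<close> an independent set of maximum size, hence a basis.\<close>
  have "Y \<inter> set (take n xs) = Y" if "indep Y" for Y
    using indep_subset_ground[OF that] xs(1) unfolding n_def by auto
  then have "card X = rank"
    using X(2)[of n] X(1) exists_indep_rank card_indep_le_rank le_antisym order_refl by metis
  then have basisX: "basis X"
    using X(1) basis_iff by blast
  define M where "M = {i. i < n \<and> \<phi> i \<in> X}"
  then have M_sub: "M \<subseteq> {..<n}"
    by auto
  have img_M: "\<phi> ` M = X"
    unfolding M_def using img_E basis_subset[OF basisX] by auto
  have count_img: "card (A \<inter> {..<i}) = card (\<phi> ` A \<inter> set (take i xs))"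
    if "A \<subseteq> {..<n}" "i \<le> n" for A i
  proof -
    have "\<phi> ` (A \<inter> {..<i}) = \<phi> ` A \<inter> \<phi> ` {..<i}"
      using inj that by (intro inj_on_image_Int) auto
    moreover have "card (\<phi> ` (A \<inter> {..<i})) = card (A \<inter> {..<i})"
      using that by (intro card_img) auto
    ultimately show ?thesis
      using prefix_img that by simp
  qed
  interpret assumable_shifted_family \<B> n rank M
  proof
    show "A \<subseteq> {..<n}" if "A \<in> \<B>" for A
      using that unfolding \<B>_def by blast
    show "card A = rank" if "A \<in> \<B>" for A
      using that card_img basis_card unfolding \<B>_def by force
    show "insert t (A - {s}) \<in> \<B>" if A: "A \<in> \<B>" "s \<in> A" "t \<notin> A" "s < t" "t < n" for A s t
    proof -
      have sub: "A \<subseteq> {..<n}" "basis (\<phi> ` A)"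
        using A unfolding \<B>_def by auto
      have "\<phi> t \<notin> \<phi> ` A"
        using inj A sub by (metis inj_on_image_mem_iff lessThan_iff)
      moreover have "weaker (\<phi> s) (\<phi> t)"
        unfolding \<phi>_def using xs(3) A n_def by blast
      ultimately have "basis (insert (\<phi> t) (\<phi> ` A - {\<phi> s}))"
        using sub A unfolding weaker_def by blast
      moreover have "\<phi> ` (A - {s}) = \<phi> ` A - {\<phi> s}"
        using inj_on_image_set_diff[OF inj, of A "{s}"] sub A by auto
      ultimately show ?thesis
        unfolding \<B>_def using sub A by auto
    qed
    show "M \<in> \<B>"
      unfolding \<B>_def using img_M basisX M_def by auto
    show "card (A \<inter> {..<i}) \<le> card (M \<inter> {..<i})" if "A \<in> \<B>" for A i
    proof -
      have A: "A \<subseteq> {..<n}" "basis (\<phi> ` A)"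
        using that unfolding \<B>_def by auto
      have le: "card (A \<inter> {..<j}) \<le> card (M \<inter> {..<j})" if "j \<le> n" for j
        using count_img[OF A(1) that] count_img[OF M_sub that] X(2)[OF that, of "\<phi> ` A"] A(2) img_M
        unfolding basis_def by simp
      \<comment> \<open>The greedy bound is available only up to \<open>n\<close>, while the locale
        asks for all \<open>i\<close>; beyond \<open>n\<close> the counts no longer change.\<close>
      have cut: "C \<inter> {..<i} = C \<inter> {..<min i n}" if "C \<subseteq> {..<n}" for C
        using that by auto
      show ?thesis
        using le[of "min i n"] cut[OF A(1)] cut[OF M_sub] by simp
    qed
    show False
      if "B1 \<in> \<B>" "B2 \<in> \<B>" and D1: "D1 \<subseteq> {..<n}" "card D1 = rank" "D1 \<notin> \<B>"
        and D2: "D2 \<subseteq> {..<n}" "card D2 = rank" "D2 \<notin> \<B>"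
        and eq: "B1 \<union> B2 = D1 \<union> D2" "B1 \<inter> B2 = D1 \<inter> D2" for B1 B2 D1 D2
    proof -
      have B: "B1 \<subseteq> {..<n}" "B2 \<subseteq> {..<n}" "basis (\<phi> ` B1)" "basis (\<phi> ` B2)"
        using that unfolding \<B>_def by auto
      have "\<phi> ` B1 \<union> \<phi> ` B2 = \<phi> ` D1 \<union> \<phi> ` D2"
        using eq(1) by (metis image_Un)
      moreover have "\<phi> ` B1 \<inter> \<phi> ` B2 = \<phi> ` D1 \<inter> \<phi> ` D2"
        using eq(2) inj_on_image_Int[OF inj] B D1 D2 by metis
      moreover have "\<phi> ` D1 \<subseteq> E" "\<phi> ` D2 \<subseteq> E"
        using D1 D2 img_E by blast+
      ultimately have "basis (\<phi> ` D1) \<or> basis (\<phi> ` D2)"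
        using assumableD[OF assms(1) B(3,4)] card_img D1 D2 by metis
      then show False
        using D1 D2 unfolding \<B>_def by blast
    qed
  qed
  obtain w :: "nat \<Rightarrow> real"
    where w: "\<And>A. A \<subseteq> {..<n} \<Longrightarrow> card A = rank \<Longrightarrow> A \<in> \<B> \<longleftrightarrow> (\<Sum>a\<in>A. w a) > 0"
    using separable_family[OF assms(2)] unfolding separable_def by blast
  define v where "v e = w (the_inv_into {..<n} \<phi> e)" for e
  have "basis B \<longleftrightarrow> (\<Sum>b\<in>B. v b) > 0" if B: "B \<subseteq> E" "card B = rank" for B
  proof -
    from B(1) obtain A where A: "A \<subseteq> {..<n}" "B = \<phi> ` A"
      unfolding img_E[symmetric] by (rule subset_imageE)
    have "(\<Sum>b\<in>B. v b) = (\<Sum>a\<in>A. v (\<phi> a))"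
      unfolding A(2) using sum.reindex[OF inj_sub[OF A(1)], of v] by simp
    also have "\<dots> = (\<Sum>a\<in>A. w a)"
      unfolding v_def using A(1) inj by (intro sum.cong) (auto simp: the_inv_into_f_f)
    finally have "(\<Sum>b\<in>B. v b) = (\<Sum>a\<in>A. w a)" .
    moreover have "card A = rank"
      using B A card_img by simp
    moreover have "basis B \<longleftrightarrow> A \<in> \<B>"
      using A unfolding \<B>_def by simp
    ultimately show ?thesis
      using w[OF A(1)] by simp
  qed
  then show ?thesis
    unfolding threshold_def by blast
qed

end

text \<open>The hypothesis \<open>k \<ge> 1\<close> excludes rank 0, where the empty basis has
  weight 0 and (1) fails, while (2) and (3) hold vacuously for lack of non-bases.\<close>

theorem theorem3:
  fixes E :: "'a set" and indep :: "'a set \<Rightarrow> bool" and k :: nat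
  assumes "matroid E indep"
    and "matroid.rank indep = k"
    and "k \<ge> 1"
  shows "(matroid.threshold E indep \<longleftrightarrow> matroid.two_uniform_assumable E indep) \<and>
    (matroid.two_uniform_assumable E indep \<longleftrightarrow>
      (\<forall>B1 B2 D1 D2. matroid.basis indep B1 \<longrightarrow> matroid.basis indep B2 \<longrightarrow>
        matroid.nonbasis E indep D1 \<longrightarrow> matroid.nonbasis E indep D2 \<longrightarrow>
        B1 \<union> B2 \<noteq> D1 \<union> D2 \<or> B1 \<inter> B2 \<noteq> D1 \<inter> D2))"
proof -
  interpret matroid E indep
    by fact
  show ?thesis
    using two_uniform_assumable_iff assumable_if_threshold threshold_if_assumable assms(2,3)
    unfolding assumable_def by blast
qed

end
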